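(* For any integers $n,k\ge 0$ we have \[ \mathrm{pc}_+^k(n) = \sum_{i+2j=n-3k} \binom{i+k-1}{i}\binom{j+k}{j}2^{j+k}, \] \[ \mathrm{ac}_+^k(n) = \sum_{2r+i+j=n-2k} \binom{r+k}{r}\binom{r}{i}\binom{r+j-1}{j}. \]
   Context: A composition of $n$ is a finite sequence $\alpha=(\alpha_1,\ldots,\alpha_\ell)$ of positive integers with $\alpha_1+\cdots+\alpha_\ell=n$; the empty sequence ($\ell=0$) is the only composition of $0$. $\mathrm{pc}_+^k(n)$ is the number of compositions $\alpha=(\alpha_1,\ldots,\alpha_\ell)$ of $n$ such that $\#\{1\le i\le \ell/2:\alpha_i\ne\alpha_{\ell+1-i}\}=k$ and either $\ell$ is even, or $\ell$ is odd and the middle part $\alpha_{(\ell+1)/2}$ is even. $\mathrm{ac}_+^k(n)$ is the number of compositions $\alpha=(\alpha_1,\ldots,\alpha_\ell)$ of $n$ such that $\#\{1\le i\le \ell/2:\alpha_i=\alpha_{\ell+1-i}\}=k$ and either $\ell$ is even, or $\ell$ is odd and $\alpha_{(\ell+1)/2}$ is even. Convention for binomial coefficients, for integers $a,b$: $\binom{a}{b}=\frac{a!}{b!(a-b)!}$ if $a\ge b\ge1$; $\binom{a}{b}=1$ if $b=0$ (for every integer $a$, including $a=-1$); $\binom{a}{b}=0$ otherwise. Summation indices range over nonnegative integers. *)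

theory Defs
  imports Main
begin

definition compositions :: "nat \<Rightarrow> nat list set" where
  "compositions n = {\<alpha>. (\<forall>a\<in>set \<alpha>. a \<ge> 1) \<and> sum_list \<alpha> = n}"

(* 1-based access to the parts: part \<alpha> i is \<alpha>_i for 1 \<le> i \<le> length \<alpha>. *)
definition part :: "nat list \<Rightarrow> nat \<Rightarrow> nat" where
  "part \<alpha> i = \<alpha> ! (i - 1)"

(* The bound i \<le> l/2 is written 2 * i \<le> l, so the middle part of a sequence of
   odd length is not compared with itself. *)
definition unequal_pairs :: "nat list \<Rightarrow> nat" where
  "unequal_pairs \<alpha> =
     card {i. 1 \<le> i \<and> 2 * i \<le> length \<alpha> \<and> part \<alpha> i \<noteq> part \<alpha> (length \<alpha> + 1 - i)}"

definition equal_pairs :: "nat list \<Rightarrow> nat" where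
  "equal_pairs \<alpha> =
     card {i. 1 \<le> i \<and> 2 * i \<le> length \<alpha> \<and> part \<alpha> i = part \<alpha> (length \<alpha> + 1 - i)}"

definition even_middle :: "nat list \<Rightarrow> bool" where
  "even_middle \<alpha> \<longleftrightarrow>
     even (length \<alpha>) \<or> (odd (length \<alpha>) \<and> even (part \<alpha> ((length \<alpha> + 1) div 2)))"

definition pc_plus :: "nat \<Rightarrow> nat \<Rightarrow> nat" where
  "pc_plus k n = card {\<alpha> \<in> compositions n. unequal_pairs \<alpha> = k \<and> even_middle \<alpha>}"

definition ac_plus :: "nat \<Rightarrow> nat \<Rightarrow> nat" where
  "ac_plus k n = card {\<alpha> \<in> compositions n. equal_pairs \<alpha> = k \<and> even_middle \<alpha>}"

(* Binomial coefficients of integers; in particular ibinom (-1) 0 = 1, and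
   ibinom a b = 0 for every a < b with b \<ge> 1 (unlike gchoose, for which
   (-1) gchoose b = (-1) ^ b). *)
definition ibinom :: "int \<Rightarrow> int \<Rightarrow> nat" where
  "ibinom a b =
     (if b = 0 then 1 else if 1 \<le> b \<and> b \<le> a then nat a choose nat b else 0)"

end

theory Submission
  imports Defs "HOL-Computational_Algebra.Formal_Power_Series"
begin

text \<open>
  Both counts are instances of one problem. Fix a relation \<open>R\<close> on the parts and let \<open>F\<^sub>k\<close> be the
  generating function of the admissible compositions (length even or middle part even) having exactly
  \<open>k\<close> opposite pairs related by \<open>R\<close>; unequal pairs are \<open>R = (\<noteq>)\<close> and equal pairs are \<open>R = (=)\<close>.
  A composition is empty, a single part, or \<open>a # \<beta> @ [b]\<close>, and in the last case \<open>\<beta>\<close> has the same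
  middle part and loses just the pair \<open>(a, b)\<close>. With \<open>M\<close> and \<open>N\<close> the generating functions of the
  pairs \<open>(a, b)\<close>, weighted by \<open>a + b\<close>, that satisfy and violate \<open>R\<close>, this gives
  \<open>F\<^sub>0 = 1 / (1 - X\<^sup>2) + N F\<^sub>0\<close> and \<open>F\<^sub>k\<^sub>+\<^sub>1 = N F\<^sub>k\<^sub>+\<^sub>1 + M F\<^sub>k\<close>, hence
  \<open>F\<^sub>k (1 - N)\<^sup>k\<^sup>+\<^sup>1 = M\<^sup>k / (1 - X\<^sup>2)\<close> (lemma \<open>comps_fps_power\<close>).

  Equal pairs have the generating function \<open>X\<^sup>2 / (1 - X\<^sup>2)\<close> and unequal ones
  \<open>2 X\<^sup>3 / ((1 - X) (1 - X\<^sup>2))\<close>. Clearing the denominators \<open>1 - X\<^sup>2\<close> leaves, with \<open>g = 1 / (1 - X)\<close>,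

  \<^item> \<open>(2 X\<^sup>3 g)\<^sup>k / (1 - 2 X\<^sup>2)\<^sup>k\<^sup>+\<^sup>1\<close> for \<open>R = (\<noteq>)\<close>, and
  \<^item> \<open>X\<^sup>2\<^sup>k / (1 - X\<^sup>2 (1 + X) g)\<^sup>k\<^sup>+\<^sup>1\<close> for \<open>R = (=)\<close>.

  Each denominator is \<open>(1 - Y)\<^sup>k\<^sup>+\<^sup>1\<close> for some \<open>Y\<close> without constant term, so the quotient is
  obtained by substituting \<open>Y\<close> into \<open>g\<^sup>k\<^sup>+\<^sup>1\<close>. The coefficient of \<open>X\<^sup>i\<close> in \<open>g\<^sup>m\<close> is the number
  \<open>ibinom (i + m - 1) i\<close>, and for \<open>m = 0\<close> this is exactly what the convention for \<open>ibinom\<close> at upper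
  argument \<open>-1\<close> provides. Reading off coefficients yields the two sums.
\<close>

unbundle fps_syntax

section \<open>Peeling off the outermost pair\<close>

text \<open>
  The common generalisation of \<open>unequal_pairs\<close> and \<open>equal_pairs\<close>, which are its instances for
  \<open>R = (\<noteq>)\<close> and \<open>R = (=)\<close>.
\<close>
definition related_pairs :: "(nat \<Rightarrow> nat \<Rightarrow> bool) \<Rightarrow> nat list \<Rightarrow> nat" where
  "related_pairs R \<alpha> =
     card {i. 1 \<le> i \<and> 2 * i \<le> length \<alpha> \<and> R (part \<alpha> i) (part \<alpha> (length \<alpha> + 1 - i))}"

definition comps :: "(nat \<Rightarrow> nat \<Rightarrow> bool) \<Rightarrow> nat \<Rightarrow> nat \<Rightarrow> nat list set" where
  "comps R k n = {\<alpha> \<in> compositions n. related_pairs R \<alpha> = k \<and> even_middle \<alpha>}"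

lemma finite_compositions: "finite (compositions n)"
proof (rule finite_subset)
  have "length \<alpha> \<le> sum_list \<alpha>" if "\<forall>a\<in>set \<alpha>. a \<ge> 1" for \<alpha> :: "nat list"
    using that by (induction \<alpha>) auto
  then show "compositions n \<subseteq> {\<alpha>. set \<alpha> \<subseteq> {0..n} \<and> length \<alpha> \<le> n}"
    using member_le_sum_list by (fastforce simp: compositions_def)
qed (rule finite_lists_length_le, simp)

lemma finite_comps: "finite (comps R k n)"
  by (simp add: comps_def finite_compositions)

lemma short_list_cases:
  obtains "\<alpha> = []" | m where "\<alpha> = [m]" | a \<beta> b where "\<alpha> = a # \<beta> @ [b]"
  by (metis list.exhaust rev_exhaust)

lemma related_pairs_short: "length \<alpha> \<le> 1 \<Longrightarrow> related_pairs R \<alpha> = 0"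
  unfolding related_pairs_def by (subst card_eq_0_iff) auto

text \<open>
  Wrapping shifts every opposite pair of \<open>\<beta>\<close> one position inwards, from index \<open>j\<close> to \<open>j + 1\<close>, and puts
  the new pair \<open>(a, b)\<close> at index \<open>1\<close>.
\<close>
lemma related_pairs_wrap:
  "related_pairs R (a # \<beta> @ [b]) = (if R a b then 1 else 0) + related_pairs R \<beta>"
proof -
  let ?S = "\<lambda>\<alpha>. {i. 1 \<le> i \<and> 2 * i \<le> length \<alpha> \<and> R (part \<alpha> i) (part \<alpha> (length \<alpha> + 1 - i))}"
  let ?\<alpha> = "a # \<beta> @ [b]"
  have inner: "part ?\<alpha> (Suc j) = part \<beta> j"
    if "1 \<le> j" "j \<le> length \<beta>" for j
    using that by (cases j) (auto simp: Defs.part_def nth_append)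
  have ends: "part ?\<alpha> 1 = a" "part ?\<alpha> (length \<beta> + 2) = b"
    by (auto simp: Defs.part_def)
  have step: "Suc j \<in> ?S ?\<alpha> \<longleftrightarrow> j \<in> ?S \<beta>" if "1 \<le> j" for j
  proof (cases "2 * j \<le> length \<beta>")
    case True
    then have "length ?\<alpha> + 1 - Suc j = Suc (length \<beta> + 1 - j)" by simp
    moreover have "part ?\<alpha> (Suc (length \<beta> + 1 - j)) = part \<beta> (length \<beta> + 1 - j)"
      using True that by (intro inner) auto
    ultimately show ?thesis
      using True that inner[of j] by simp
  qed simp
  have one: "1 \<in> ?S ?\<alpha> \<longleftrightarrow> R a b"
    using ends by simp
  have S: "?S ?\<alpha> = (if R a b then {1} else {}) \<union> Suc ` ?S \<beta>"
  proof (rule set_eqI)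
    fix i
    consider "i = 0" | "i = 1" | j where "i = Suc j" "1 \<le> j"
      by (cases i; cases "i - 1") auto
    then show "i \<in> ?S ?\<alpha> \<longleftrightarrow> i \<in> (if R a b then {1} else {}) \<union> Suc ` ?S \<beta>"
    proof cases
      case 1 then show ?thesis by auto
    next
      case 2
      have "1 \<notin> Suc ` ?S \<beta>" by auto
      with one 2 show ?thesis by (simp only: Un_iff) auto
    next
      case 3
      have "i \<in> Suc ` ?S \<beta> \<longleftrightarrow> j \<in> ?S \<beta>" using 3 by (auto simp del: mem_Collect_eq)
      with step[OF 3(2)] 3 show ?thesis by (simp only: Un_iff) auto
    qed
  qed
  have fin: "finite (?S \<beta>)"
    by (rule finite_subset[of _ "{..length \<beta>}"]) auto
  have "card (?S ?\<alpha>) = card (if R a b then {1::nat} else {}) + card (Suc ` ?S \<beta>)"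
    unfolding S by (rule card_Un_disjoint) (use fin in auto)
  then show ?thesis
    by (simp add: related_pairs_def card_image)
qed

lemma even_middle_wrap: "even_middle (a # \<beta> @ [b]) \<longleftrightarrow> even_middle \<beta>"
proof (cases "even (length \<beta>)")
  case False
  then obtain m where "length \<beta> = 2 * m + 1" by (elim oddE)
  then show ?thesis by (simp add: even_middle_def Defs.part_def nth_append)
qed (simp add: even_middle_def)

text \<open>
  The weight \<open>a + b\<close> is taken off \<open>n\<close> before \<open>K\<close> is consulted, so that on generating functions
  wrapping becomes multiplication by the series of the admitted pairs.
\<close>
definition wrapped :: "(nat \<Rightarrow> nat \<Rightarrow> bool) \<Rightarrow> (nat \<Rightarrow> nat list set) \<Rightarrow> nat \<Rightarrow> nat list set" where
  "wrapped R K n =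
     {a # \<beta> @ [b] | a b \<beta>. 1 \<le> a \<and> 1 \<le> b \<and> a + b \<le> n \<and> R a b \<and> \<beta> \<in> K (n - (a + b))}"

lemma compositions_wrap:
  "a # \<beta> @ [b] \<in> compositions n \<longleftrightarrow>
     1 \<le> a \<and> 1 \<le> b \<and> a + b \<le> n \<and> \<beta> \<in> compositions (n - (a + b))"
  by (auto simp: compositions_def)

lemma comps_wrap_iff:
  "a # \<beta> @ [b] \<in> comps R k n \<longleftrightarrow>
     1 \<le> a \<and> 1 \<le> b \<and> a + b \<le> n \<and>
       (\<not> R a b \<and> \<beta> \<in> comps R k (n - (a + b)) \<or>
        R a b \<and> k \<noteq> 0 \<and> \<beta> \<in> comps R (k - 1) (n - (a + b)))"
  by (auto simp: comps_def compositions_wrap related_pairs_wrap even_middle_wrap)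

lemma wrap_in_wrapped_iff:
  "a # \<beta> @ [b] \<in> wrapped R K n \<longleftrightarrow>
     1 \<le> a \<and> 1 \<le> b \<and> a + b \<le> n \<and> R a b \<and> \<beta> \<in> K (n - (a + b))"
  by (auto simp: wrapped_def)

lemma short_not_wrapped: "[] \<notin> wrapped R K n" "[m] \<notin> wrapped R K n"
  by (auto simp: wrapped_def)

lemma wrapped_disjoint: "wrapped (\<lambda>a b. \<not> R a b) K n \<inter> wrapped R L n = {}"
  unfolding wrapped_def by blast

text \<open>
  The unwrapped compositions that survive are the empty one and a single even part: one for
  each even \<open>n\<close>. They have no pair at all, which is why they occur for \<open>k = 0\<close> only.
\<close>
lemma comps_0_decompose:
  "comps R 0 n =
     (if odd n then {} else if n = 0 then {[]} else {[n]}) \<union>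
     wrapped (\<lambda>a b. \<not> R a b) (comps R 0) n"
proof (rule set_eqI)
  fix \<alpha>
  show "\<alpha> \<in> comps R 0 n \<longleftrightarrow> \<alpha> \<in> (if odd n then {} else if n = 0 then {[]} else {[n]}) \<union>
     wrapped (\<lambda>a b. \<not> R a b) (comps R 0) n"
  proof (cases \<alpha> rule: short_list_cases)
    case 1
    then show ?thesis
      by (auto simp: comps_def compositions_def related_pairs_short even_middle_def
          short_not_wrapped)
  next
    case 2
    then show ?thesis
      by (auto simp: comps_def compositions_def related_pairs_short even_middle_def Defs.part_def
          short_not_wrapped)
  next
    case 3
    then show ?thesis
      by (auto simp: comps_wrap_iff wrap_in_wrapped_iff split: if_splits)
  qed
qed

lemma comps_Suc_decompose:
  "comps R (Suc k) n =
     wrapped (\<lambda>a b. \<not> R a b) (comps R (Suc k)) n \<union> wrapped R (comps R k) n"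
proof (rule set_eqI)
  fix \<alpha>
  show "\<alpha> \<in> comps R (Suc k) n \<longleftrightarrow>
    \<alpha> \<in> wrapped (\<lambda>a b. \<not> R a b) (comps R (Suc k)) n \<union> wrapped R (comps R k) n"
  proof (cases \<alpha> rule: short_list_cases)
    case 3
    then show ?thesis
      by (auto simp: comps_wrap_iff wrap_in_wrapped_iff)
  qed (auto simp: comps_def related_pairs_short short_not_wrapped)
qed

section \<open>Generating functions\<close>

definition counting_fps :: "(nat \<Rightarrow> 'a set) \<Rightarrow> rat fps" where
  "counting_fps K = Abs_fps (\<lambda>n. of_nat (card (K n)))"

definition pairs_of_sum :: "(nat \<Rightarrow> nat \<Rightarrow> bool) \<Rightarrow> nat \<Rightarrow> (nat \<times> nat) set" where
  "pairs_of_sum R n = {(a, b). 1 \<le> a \<and> 1 \<le> b \<and> a + b = n \<and> R a b}"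

abbreviation pairs_fps :: "(nat \<Rightarrow> nat \<Rightarrow> bool) \<Rightarrow> rat fps" where
  "pairs_fps R \<equiv> counting_fps (pairs_of_sum R)"

abbreviation comps_fps :: "(nat \<Rightarrow> nat \<Rightarrow> bool) \<Rightarrow> nat \<Rightarrow> rat fps" where
  "comps_fps R k \<equiv> counting_fps (comps R k)"

lemma finite_pairs_of_sum: "finite (pairs_of_sum R n)"
  by (rule finite_subset[of _ "{..n} \<times> {..n}"]) (auto simp: pairs_of_sum_def)

lemma wrapped_eq_image:
  "wrapped R K n =
     (\<lambda>(d, (a, b), \<beta>). a # \<beta> @ [b]) ` (SIGMA d:{0..n}. pairs_of_sum R d \<times> K (n - d))"
  by (force simp: wrapped_def pairs_of_sum_def image_iff)

lemma finite_wrapped: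
  assumes "\<And>n. finite (K n)"
  shows "finite (wrapped R K n)"
  unfolding wrapped_eq_image using assms by (auto intro!: finite_SigmaI finite_pairs_of_sum)

text \<open>
  A wrapped list determines \<open>a\<close>, \<open>b\<close> and \<open>\<beta>\<close>, so its counting sequence is the convolution over
  the weight \<open>d = a + b\<close> of the outer pair.
\<close>
lemma wrapped_fps:
  assumes "\<And>n. finite (K n)"
  shows "counting_fps (wrapped R K) = pairs_fps R * counting_fps K"
proof (rule fps_ext)
  fix n
  have "inj_on (\<lambda>(d, (a, b), \<beta>). a # \<beta> @ [b])
          (SIGMA d:{0..n}. pairs_of_sum R d \<times> K (n - d))"
    by (auto simp: inj_on_def pairs_of_sum_def)
  then have "card (wrapped R K n) = (\<Sum>d=0..n. card (pairs_of_sum R d) * card (K (n - d)))"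
    using assms unfolding wrapped_eq_image
    by (subst card_image) (auto simp: card_cartesian_product finite_pairs_of_sum)
  then show "counting_fps (wrapped R K) $ n = (pairs_fps R * counting_fps K) $ n"
    by (simp add: counting_fps_def fps_mult_nth)
qed

lemma counting_fps_Un:
  assumes "\<And>n. finite (K n)" "\<And>n. finite (L n)" "\<And>n. K n \<inter> L n = {}"
  shows "counting_fps (\<lambda>n. K n \<union> L n) = counting_fps K + counting_fps L"
  using assms by (intro fps_ext) (simp add: counting_fps_def card_Un_disjoint)

text \<open>
  The series \<open>1 / (1 - X\<^sup>2)\<close>, counting the possible middles (none, or one even part) by size.
\<close>
definition even_fps :: "rat fps" where
  "even_fps = Abs_fps (\<lambda>n. if even n then 1 else 0)"

lemma even_fps_mult: "even_fps * (1 - fps_X ^ 2) = 1"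
proof (rule fps_ext)
  show "(even_fps * (1 - fps_X ^ 2)) $ n = 1 $ n" for n
    by (cases n rule: nat.exhaust; cases "n - 1")
      (auto simp: even_fps_def right_diff_distrib fps_X_power_mult_right_nth)
qed

lemma comps_fps_0: "comps_fps R 0 * (1 - pairs_fps (\<lambda>a b. \<not> R a b)) = even_fps"
proof -
  let ?core = "\<lambda>n. if odd n then {} else if n = 0 then {[]} else {[n :: nat]}"
  have "comps_fps R 0 = counting_fps (\<lambda>n. ?core n \<union> wrapped (\<lambda>a b. \<not> R a b) (comps R 0) n)"
    by (intro arg_cong[of _ _ counting_fps] ext comps_0_decompose)
  also have "\<dots> = counting_fps ?core + counting_fps (wrapped (\<lambda>a b. \<not> R a b) (comps R 0))"
    by (rule counting_fps_Un) (auto simp: finite_wrapped finite_comps short_not_wrapped)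
  also have "counting_fps ?core = even_fps"
    by (rule fps_ext) (simp add: counting_fps_def even_fps_def)
  also have "counting_fps (wrapped (\<lambda>a b. \<not> R a b) (comps R 0)) =
      pairs_fps (\<lambda>a b. \<not> R a b) * comps_fps R 0"
    by (rule wrapped_fps) (rule finite_comps)
  finally have "comps_fps R 0 - pairs_fps (\<lambda>a b. \<not> R a b) * comps_fps R 0 = even_fps"
    by (metis add_diff_cancel_right')
  then show ?thesis
    by (simp add: right_diff_distrib mult.commute)
qed

lemma comps_fps_Suc:
  "comps_fps R (Suc k) * (1 - pairs_fps (\<lambda>a b. \<not> R a b)) = pairs_fps R * comps_fps R k"
proof -
  have "comps_fps R (Suc k) = counting_fps
      (\<lambda>n. wrapped (\<lambda>a b. \<not> R a b) (comps R (Suc k)) n \<union> wrapped R (comps R k) n)"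
    by (intro arg_cong[of _ _ counting_fps] ext comps_Suc_decompose)
  also have "\<dots> = counting_fps (wrapped (\<lambda>a b. \<not> R a b) (comps R (Suc k))) +
      counting_fps (wrapped R (comps R k))"
    by (rule counting_fps_Un) (simp_all add: finite_wrapped finite_comps wrapped_disjoint)
  also have "counting_fps (wrapped (\<lambda>a b. \<not> R a b) (comps R (Suc k))) =
      pairs_fps (\<lambda>a b. \<not> R a b) * comps_fps R (Suc k)"
    by (rule wrapped_fps) (rule finite_comps)
  also have "counting_fps (wrapped R (comps R k)) = pairs_fps R * comps_fps R k"
    by (rule wrapped_fps) (rule finite_comps)
  finally have "comps_fps R (Suc k) - pairs_fps (\<lambda>a b. \<not> R a b) * comps_fps R (Suc k) = pairs_fps R * comps_fps R k"
    by (metis add_diff_cancel_left')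
  then show ?thesis
    by (simp add: right_diff_distrib mult.commute)
qed

lemma comps_fps_power:
  "comps_fps R k * (1 - pairs_fps (\<lambda>a b. \<not> R a b)) ^ Suc k = pairs_fps R ^ k * even_fps"
proof (induction k)
  case 0
  show ?case by (simp add: comps_fps_0)
next
  case (Suc k)
  let ?u = "1 - pairs_fps (\<lambda>a b. \<not> R a b)"
  have "comps_fps R (Suc k) * ?u ^ Suc (Suc k) = (comps_fps R (Suc k) * ?u) * ?u ^ Suc k"
    by (simp add: mult_ac)
  also have "\<dots> = pairs_fps R * (comps_fps R k * ?u ^ Suc k)"
    unfolding comps_fps_Suc by (simp add: mult_ac)
  also have "\<dots> = pairs_fps R ^ Suc k * even_fps"
    unfolding Suc.IH by (simp add: mult_ac)
  finally show ?case .
qed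

text \<open>
  The series of equal pairs and of unequal pairs both have \<open>1 - X\<^sup>2\<close> as a denominator. In the formula
  \<open>comps_fps_power\<close> that factor comes \<open>k\<close> times from the related pairs and once from the middle,
  which matches the \<open>k + 1\<close> factors needed to clear the power on the left.
\<close>
lemma comps_fps_power_cleared:
  "comps_fps R k * ((1 - pairs_fps (\<lambda>a b. \<not> R a b)) * (1 - fps_X ^ 2)) ^ Suc k =
     (pairs_fps R * (1 - fps_X ^ 2)) ^ k"
proof -
  let ?u = "1 - pairs_fps (\<lambda>a b. \<not> R a b)" and ?c = "1 - fps_X ^ 2 :: rat fps"
  have "comps_fps R k * (?u * ?c) ^ Suc k = (comps_fps R k * ?u ^ Suc k) * ?c ^ Suc k"
    by (simp only: power_mult_distrib mult_ac)
  also have "\<dots> = (pairs_fps R * ?c) ^ k * (even_fps * ?c)"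
    unfolding comps_fps_power by (simp add: power_mult_distrib mult_ac)
  finally show ?thesis
    by (simp add: even_fps_mult)
qed

section \<open>Equal and unequal pairs\<close>

definition geom :: "rat fps" where
  "geom = inverse (1 - fps_X)"

lemma geom_eq: "geom = Abs_fps (\<lambda>_. 1)"
  unfolding geom_def by (rule fps_inverse_one_minus_fps_X)

lemma geom_mult: "(1 - fps_X) * geom = 1"
  unfolding geom_def by (rule inverse_mult_eq_1') simp

text \<open>
  This identity, obtained from \<open>X\<^sup>2 = X\<^sup>2 (1 - X) g\<close>, is what turns \<open>1 - X\<^sup>2 - 2 X\<^sup>3 g\<close> into
  \<open>1 - Y\<close> with \<open>Y = X\<^sup>2 (1 + X) g\<close>, whose powers expand into binomial coefficients.
\<close>
lemma X2_one_plus_X_geom: "fps_X ^ 2 * (1 + fps_X) * geom = fps_X ^ 2 + 2 * fps_X ^ 3 * geom"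
proof -
  have "fps_X ^ 2 * (1 + fps_X) * geom = fps_X ^ 2 * ((1 - fps_X) * geom) + 2 * fps_X ^ 3 * geom"
    by (simp add: power2_eq_square power3_eq_cube algebra_simps)
  then show ?thesis
    by (simp add: geom_mult)
qed

lemma pairs_fps_True: "pairs_fps (\<lambda>_ _. True) = (fps_X * geom) ^ 2"
proof (rule fps_ext)
  fix n
  have "pairs_of_sum (\<lambda>_ _. True) n = (\<lambda>a. (a, n - a)) ` {1..<n}"
    by (auto simp: pairs_of_sum_def image_iff)
  then have "card (pairs_of_sum (\<lambda>_ _. True) n) = n - 1"
    by (simp add: card_image inj_on_def)
  moreover have "(fps_X * geom) ^ 2 = fps_X ^ 2 * Abs_fps (\<lambda>n. of_nat (n + 1))"
    unfolding geom_def power_mult_distrib fps_inverse_power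
    by (simp only: fps_inverse_power[symmetric] fps_one_over_one_minus_fps_X_squared)
  ultimately show "pairs_fps (\<lambda>_ _. True) $ n = ((fps_X * geom) ^ 2) $ n"
    by (simp add: counting_fps_def fps_X_power_mult_nth of_nat_diff)
qed

lemma pairs_fps_eq_mult: "pairs_fps (=) * (1 - fps_X ^ 2) = fps_X ^ 2"
proof -
  have "pairs_of_sum (=) n = (if even n \<and> 2 \<le> n then {(n div 2, n div 2)} else {})" for n
    by (auto simp: pairs_of_sum_def)
  then have "pairs_fps (=) = fps_X ^ 2 * even_fps"
    by (intro fps_ext) (auto simp: counting_fps_def even_fps_def fps_X_power_mult_nth)
  then show ?thesis
    by (simp add: mult.assoc even_fps_mult)
qed

text \<open>
  Unequal pairs are all pairs minus the equal ones: \<open>X\<^sup>2 g\<^sup>2 - X\<^sup>2 / (1 - X\<^sup>2)\<close>.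
\<close>
lemma pairs_fps_neq_mult: "pairs_fps (\<noteq>) * (1 - fps_X ^ 2) = 2 * fps_X ^ 3 * geom"
proof -
  have "pairs_fps (\<lambda>_ _. True) = counting_fps (\<lambda>n. pairs_of_sum (=) n \<union> pairs_of_sum (\<noteq>) n)"
    by (intro arg_cong[of _ _ counting_fps] ext) (auto simp: pairs_of_sum_def)
  also have "\<dots> = pairs_fps (=) + pairs_fps (\<noteq>)"
    by (rule counting_fps_Un) (auto simp: finite_pairs_of_sum, auto simp: pairs_of_sum_def)
  finally have "pairs_fps (\<noteq>) = (fps_X * geom) ^ 2 - pairs_fps (=)"
    by (simp add: pairs_fps_True)
  then have "pairs_fps (\<noteq>) * (1 - fps_X ^ 2) =
      (fps_X * geom) ^ 2 * (1 - fps_X ^ 2) - pairs_fps (=) * (1 - fps_X ^ 2)"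
    by (simp only: left_diff_distrib)
  also have "(fps_X * geom) ^ 2 * (1 - fps_X ^ 2) =
      fps_X ^ 2 * (1 + fps_X) * geom * ((1 - fps_X) * geom)"
    by (simp add: power2_eq_square algebra_simps)
  also have "pairs_fps (=) * (1 - fps_X ^ 2) = fps_X ^ 2 * ((1 - fps_X) * geom)"
    by (simp add: pairs_fps_eq_mult geom_mult)
  also have "fps_X ^ 2 * (1 + fps_X) * geom * ((1 - fps_X) * geom) - fps_X ^ 2 * ((1 - fps_X) * geom)
      = 2 * fps_X ^ 3 * geom"
    unfolding geom_mult by (simp add: X2_one_plus_X_geom)
  finally show ?thesis .
qed

section \<open>Extracting coefficients\<close>

lemma ibinom_of_nat: "ibinom (int a) (int b) = a choose b"
  by (auto simp: ibinom_def binomial_eq_0)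

lemma ibinom_add_Suc_minus_1: "ibinom (int i + int (Suc m) - 1) (int i) = (i + m) choose i"
  using ibinom_of_nat[of "i + m" i] by (simp add: algebra_simps)

text \<open>
  Multiplying by \<open>g\<close> forms partial sums of coefficients, so the induction step is the
  hockey-stick identity. The step from \<open>m = 0\<close> needs the value \<open>1\<close> of \<open>ibinom (-1) 0\<close> and the
  value \<open>0\<close> of \<open>ibinom (i - 1) i\<close> for \<open>i \<ge> 1\<close>.
\<close>
lemma geom_power_nth: "geom ^ m $ i = of_nat (ibinom (int i + int m - 1) (int i))"
proof (induction m arbitrary: i)
  case 0
  show ?case by (simp add: ibinom_def)
next
  case (Suc m)
  have hockey: "(\<Sum>j\<le>i. ibinom (int j + int m - 1) (int j)) = (i + m) choose i"
  proof (cases m)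
    case 0
    have "(\<Sum>j\<le>i. ibinom (int j + int m - 1) (int j)) = (\<Sum>j\<le>i. if j = 0 then 1 else 0)"
      by (rule sum.cong) (auto simp: 0 ibinom_def)
    then show ?thesis by (simp add: 0)
  next
    case (Suc l)
    then show ?thesis
      using sum_choose_lower[of l i] by (simp only: ibinom_add_Suc_minus_1) (simp add: add_ac)
  qed
  have "geom ^ Suc m $ i = (\<Sum>j=0..i. geom ^ m $ j)"
    by (subst power_Suc2, subst fps_mult_nth) (simp add: geom_eq)
  also have "\<dots> = of_nat (\<Sum>j\<le>i. ibinom (int j + int m - 1) (int j))"
    by (simp add: Suc.IH atLeast0AtMost)
  finally show ?case
    by (simp only: hockey ibinom_add_Suc_minus_1)
qed

text \<open>
  Division by \<open>(1 - Y)\<^sup>k\<^sup>+\<^sup>1\<close> as substitution: \<open>1 / (1 - Y)\<close> is \<open>g\<close> composed with \<open>Y\<close>, and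
  composition with a series without constant term respects products.
\<close>
lemma power_one_minus_solve:
  fixes F G Y :: "rat fps"
  assumes "F * (1 - Y) ^ Suc k = G" and Y0: "Y $ 0 = 0"
  shows "F = G * (geom ^ Suc k oo Y)"
proof -
  have "(1 - Y) * (geom oo Y) = ((1 - fps_X) * geom) oo Y"
    using Y0 by (simp add: fps_compose_mult_distrib fps_compose_sub_distrib)
  then have inv: "(1 - Y) * (geom oo Y) = 1"
    by (simp add: geom_mult)
  have "G * (geom ^ Suc k oo Y) = F * ((1 - Y) * (geom oo Y)) ^ Suc k"
    unfolding assms(1)[symmetric] fps_compose_power[OF Y0, symmetric]
    by (simp only: power_mult_distrib mult_ac)
  then show ?thesis
    by (simp add: inv)
qed

lemma geom_power_compose_nth:
  "(geom ^ Suc k oo Y) $ n = (\<Sum>r\<le>n. of_nat (ibinom (int r + int k) (int r)) * Y ^ r $ n)"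
  unfolding fps_compose_nth geom_power_nth by (simp add: atLeast0AtMost)

lemma comps_fps_neq: "comps_fps (\<noteq>) k = (2 * fps_X ^ 3 * geom) ^ k * (geom ^ Suc k oo 2 * fps_X ^ 2)"
proof (rule power_one_minus_solve)
  have "(1 - pairs_fps (=)) * (1 - fps_X ^ 2) = 1 - 2 * fps_X ^ 2"
    by (simp add: left_diff_distrib pairs_fps_eq_mult)
  then show "comps_fps (\<noteq>) k * (1 - 2 * fps_X ^ 2) ^ Suc k = (2 * fps_X ^ 3 * geom) ^ k"
    using comps_fps_power_cleared[of "(\<noteq>)" k] by (simp only: not_not pairs_fps_neq_mult)
qed simp

lemma comps_fps_eq:
  "comps_fps (=) k = (fps_X ^ 2) ^ k * (geom ^ Suc k oo fps_X ^ 2 * (1 + fps_X) * geom)"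
proof (rule power_one_minus_solve)
  have "(1 - pairs_fps (\<noteq>)) * (1 - fps_X ^ 2) = 1 - fps_X ^ 2 * (1 + fps_X) * geom"
    by (simp add: left_diff_distrib pairs_fps_neq_mult X2_one_plus_X_geom)
  then show "comps_fps (=) k * (1 - fps_X ^ 2 * (1 + fps_X) * geom) ^ Suc k = (fps_X ^ 2) ^ k"
    using comps_fps_power_cleared[of "(=)" k] by (simp only: pairs_fps_eq_mult)
qed simp

lemma pc_plus_card: "of_nat (pc_plus k n) = comps_fps (\<noteq>) k $ n"
  by (simp add: counting_fps_def pc_plus_def comps_def related_pairs_def unequal_pairs_def)

lemma ac_plus_card: "of_nat (ac_plus k n) = comps_fps (=) k $ n"
  by (simp add: counting_fps_def ac_plus_def comps_def related_pairs_def equal_pairs_def)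

lemma fps_mult_nth_antidiagonal:
  "(A * B) $ n = (\<Sum>(i, j) \<in> {(i, j). i + j = n}. A $ i * B $ j)"
  unfolding fps_mult_nth
  by (rule sum.reindex_bij_witness[of _ fst "\<lambda>i. (i, n - i)"]) auto

lemma one_plus_X_power_nth: "((1 + fps_X) ^ r :: rat fps) $ i = of_nat (ibinom (int r) (int i))"
  by (simp only: fps_binomial_of_nat[symmetric] fps_binomial_nth ibinom_of_nat binomial_gbinomial)

lemma two_X2_power_nth: "((2 * fps_X ^ 2) ^ j :: rat fps) $ n = (if n = 2 * j then 2 ^ j else 0)"
proof -
  have "(2 * fps_X ^ 2) ^ j = fps_const (2 ^ j) * (fps_X ^ (2 * j) :: rat fps)"
    by (simp add: power_mult_distrib power_mult[symmetric] numeral_fps_const fps_const_power)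
  then show ?thesis by (simp add: fps_X_power_nth)
qed

lemma pc_plus_formula:
  "pc_plus k n =
     (\<Sum>(i, j) \<in> {(i :: nat, j :: nat). int i + 2 * int j = int n - 3 * int k}.
        ibinom (int i + int k - 1) (int i) * ibinom (int j + int k) (int j) * 2 ^ (j + k))"
  (is "_ = sum ?f ?S")
proof -
  let ?G = "geom ^ Suc k oo 2 * fps_X ^ 2"
  have "comps_fps (\<noteq>) k = fps_X ^ (3 * k) * (fps_const (2 ^ k) * (geom ^ k * ?G))"
    unfolding comps_fps_neq
    by (simp add: power_mult_distrib power_mult[symmetric] numeral_fps_const fps_const_power mult_ac)
  then have coeff: "of_nat (pc_plus k n) =
      (if n < 3 * k then 0 else 2 ^ k * (geom ^ k * ?G) $ (n - 3 * k))"
    by (simp only: pc_plus_card fps_X_power_mult_nth fps_mult_left_const_nth)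
  show ?thesis
  proof (cases "n < 3 * k")
    case True
    then have "?S = {}" by auto
    then show ?thesis using coeff True by (simp only: if_True) simp
  next
    case False
    define N where "N = n - 3 * k"
    \<comment> \<open>The index \<open>i\<close> comes from the factor \<open>g\<^sup>k\<close>, the index \<open>j\<close> from the expansion in powers of
      \<open>2 X\<^sup>2\<close>; the constant factor \<open>2\<^sup>k\<close> is kept apart until the end.\<close>
    let ?g = "\<lambda>i j. of_nat (ibinom (int i + int k - 1) (int i)) *
      (of_nat (ibinom (int j + int k) (int j)) * 2 ^ j) :: rat"
    have "(geom ^ k * ?G) $ N = (\<Sum>i\<le>N. \<Sum>j\<le>N - i. if i + 2 * j = N then ?g i j else 0)"
      unfolding fps_mult_nth geom_power_compose_nth geom_power_nth two_X2_power_nth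
        atLeast0AtMost sum_distrib_left
      by (intro sum.cong refl) auto
    also have "\<dots> = (\<Sum>(i, j) \<in> (SIGMA i:{..N}. {..N - i}). if i + 2 * j = N then ?g i j else 0)"
      by (simp add: sum.Sigma)
    also have "\<dots> = (\<Sum>(i, j) \<in> ?S. ?g i j)"
      by (rule sum.mono_neutral_cong_right) (use False in \<open>auto simp: N_def split: if_splits\<close>)
    finally have "of_nat (pc_plus k n) = 2 ^ k * (\<Sum>(i, j) \<in> ?S. ?g i j)"
      using coeff False by (simp add: N_def)
    also have "\<dots> = of_nat (sum ?f ?S)"
      by (auto simp: sum_distrib_left of_nat_sum power_add intro!: sum.cong)
    finally show ?thesis
      by (simp only: of_nat_eq_iff)
  qed
qed

lemma ac_plus_formula:
  "ac_plus k n =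
     (\<Sum>(r, i, j) \<in> {(r :: nat, i :: nat, j :: nat).
                       2 * int r + int i + int j = int n - 2 * int k}.
        ibinom (int r + int k) (int r) * ibinom (int r) (int i)
          * ibinom (int r + int j - 1) (int j))"
  (is "_ = sum ?f ?S")
proof -
  let ?Y = "fps_X ^ 2 * (1 + fps_X) * geom"
  have coeff: "of_nat (ac_plus k n) =
      (if n < 2 * k then 0 else (geom ^ Suc k oo ?Y) $ (n - 2 * k))"
    by (simp only: ac_plus_card comps_fps_eq power_mult[symmetric] fps_X_power_mult_nth)
  show ?thesis
  proof (cases "n < 2 * k")
    case True
    then have "?S = {}" by auto
    then show ?thesis using coeff True by (simp only: if_True) simp
  next
    case False
    define N where "N = n - 2 * k"
    let ?D = "\<lambda>r. {(i, j). i + j = N - 2 * r}"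
    let ?b = "\<lambda>r. of_nat (ibinom (int r + int k) (int r)) :: rat"
    let ?c = "\<lambda>r i j. of_nat (ibinom (int r) (int i)) *
      of_nat (ibinom (int j + int r - 1) (int j)) :: rat"
    \<comment> \<open>In \<open>Y\<^sup>r = X\<^sup>2\<^sup>r (1 + X)\<^sup>r g\<^sup>r\<close> the index \<open>i\<close> comes from \<open>(1 + X)\<^sup>r\<close> and \<open>j\<close> from \<open>g\<^sup>r\<close>.\<close>
    have Y: "?Y ^ r $ N = (if N < 2 * r then 0 else \<Sum>(i, j) \<in> ?D r. ?c r i j)" for r
    proof -
      have Y_power: "?Y ^ r = fps_X ^ (2 * r) * ((1 + fps_X) ^ r * geom ^ r)"
        by (simp add: power_mult_distrib power_mult[symmetric] mult_ac)
      show ?thesis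
        unfolding Y_power fps_X_power_mult_nth
        by (simp only: fps_mult_nth_antidiagonal one_plus_X_power_nth
            geom_power_nth)
    qed
    have fin: "finite (?D r)" for r
      by (rule finite_subset[of _ "{..N} \<times> {..N}"]) auto
    have "of_nat (ac_plus k n) = (\<Sum>r\<le>N. ?b r * (?Y ^ r $ N))"
      using coeff False by (simp only: if_False geom_power_compose_nth N_def)
    also have "\<dots> = (\<Sum>r | 2 * r \<le> N. ?b r * (\<Sum>(i, j) \<in> ?D r. ?c r i j))"
      unfolding Y by (rule sum.mono_neutral_cong_right) auto
    also have "\<dots> = (\<Sum>r | 2 * r \<le> N. \<Sum>(i, j) \<in> ?D r. ?b r * ?c r i j)"
      by (simp add: sum_distrib_left case_prod_unfold)
    also have "\<dots> = (\<Sum>(r, i, j) \<in> (SIGMA r:{r. 2 * r \<le> N}. ?D r). ?b r * ?c r i j)"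
      by (rule sum.Sigma)
        (auto simp: fin intro: finite_subset[of "{r. 2 * r \<le> N}" "{..N}"])
    also have "(SIGMA r:{r. 2 * r \<le> N}. ?D r) = ?S"
      using False by (auto simp: N_def)
    also have "(\<Sum>(r, i, j) \<in> ?S. ?b r * ?c r i j) = of_nat (sum ?f ?S)"
      by (auto simp: of_nat_sum add_ac intro!: sum.cong)
    finally show ?thesis
      by (simp only: of_nat_eq_iff)
  qed
qed

theorem theorem2p1:
  fixes n k :: nat
  shows "pc_plus k n =
           (\<Sum>(i, j) \<in> {(i :: nat, j :: nat). int i + 2 * int j = int n - 3 * int k}.
              ibinom (int i + int k - 1) (int i) * ibinom (int j + int k) (int j) * 2 ^ (j + k))
       \<and> ac_plus k n =
           (\<Sum>(r, i, j) \<in> {(r :: nat, i :: nat, j :: nat).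
                             2 * int r + int i + int j = int n - 2 * int k}.
              ibinom (int r + int k) (int r) * ibinom (int r) (int i)
                * ibinom (int r + int j - 1) (int j))"
  by (intro conjI pc_plus_formula ac_plus_formula)

end
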